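(* Let $n\ge 2$, let $a_0,a_1,\dots,a_{n-1}\in\mathbb{H}$, and let $M_n[\mathbb{H}]$ be the companion matrix of the unilateral quaternionic polynomial $A_n(q)=q^n-\sum_{s=0}^{n-1}a_s\,q^s$. Let $\Phi=(\varphi_1,\varphi_2,\dots,\varphi_n)^{T}\in\mathbb{H}^n$ be an eigenvector of $M_n[\mathbb{H}]$, that is, $\Phi\neq 0$ and $M_n[\mathbb{H}]\,\Phi=\Phi\,\lambda$ for some $\lambda\in\mathbb{C}$ with $\operatorname{Im}[\lambda]\ge 0$. Then the quaternion $q=\varphi_{n-1}\,\varphi_n^{-1}$ (which is well defined, since $\varphi_n\ne 0$) is a zero of $A_n$, i.e. $A_n(q)=0$.
   Context: $\mathbb{H}$ denotes the real quaternions with units $i,j,k$, and $\mathbb{C}$ is identified with the subfield $\mathbb{R}+\mathbb{R}i\subset\mathbb{H}$. The companion matrix associated with $A_n(q)=q^n-\sum_{s=0}^{n-1}a_s q^s$ (coefficients on the left of the powers of $q$) is the $n\times n$ quaternionic matrix $$M_n[\mathbb{H}]=\begin{pmatrix} a_{n-1}&a_{n-2}&\cdots&a_1&a_0\\ 1&0&\cdots&0&0\\ 0&1&\cdots&0&0\\ \vdots&\vdots&\ddots&\vdots&\vdots\\ 0&0&\cdots&1&0\end{pmatrix},$$ that is, first row $(a_{n-1},\dots,a_0)$, ones on the subdiagonal, and zeros elsewhere. The matrix acts on column vectors by left multiplication, $(M\Phi)_r=\sum_s M_{rs}\varphi_s$, and $\Phi\lambda$ is the column vector with entries $\varphi_r\lambda$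 (right eigenvalue problem). *)

theory Defs
  imports Complex_Main "Jordan_Normal_Form.Matrix"
begin

datatype quat = Quat (qre: real) (qi: real) (qj: real) (qk: real)

lemma quat_eq_iff: "x = y \<longleftrightarrow> qre x = qre y \<and> qi x = qi y \<and> qj x = qj y \<and> qk x = qk y"
  by (auto intro: quat.expand)

definition qnorm2 :: "quat \<Rightarrow> real" where
  "qnorm2 x = (qre x)\<^sup>2 + (qi x)\<^sup>2 + (qj x)\<^sup>2 + (qk x)\<^sup>2"

instantiation quat :: real_div_algebra
begin

definition "0 = Quat 0 0 0 0"

definition "1 = Quat 1 0 0 0"

definition "x + y = Quat (qre x + qre y) (qi x + qi y) (qj x + qj y) (qk x + qk y)"

definition "- x = Quat (- qre x) (- qi x) (- qj x) (- qk x)"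

definition "x - y = Quat (qre x - qre y) (qi x - qi y) (qj x - qj y) (qk x - qk y)"

definition "x * y = Quat
  (qre x * qre y - qi x * qi y - qj x * qj y - qk x * qk y)
  (qre x * qi y + qi x * qre y + qj x * qk y - qk x * qj y)
  (qre x * qj y - qi x * qk y + qj x * qre y + qk x * qi y)
  (qre x * qk y + qi x * qj y - qj x * qi y + qk x * qre y)"

definition "r *\<^sub>R x = Quat (r * qre x) (r * qi x) (r * qj x) (r * qk x)"

definition "inverse x =
  Quat (qre x / qnorm2 x) (- qi x / qnorm2 x) (- qj x / qnorm2 x) (- qk x / qnorm2 x)"

definition "x div y = x * inverse (y :: quat)"

lemmas quat_ops = zero_quat_def one_quat_def plus_quat_def uminus_quat_def minus_quat_def
  times_quat_def scaleR_quat_def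

lemma qnorm2_eq_0: "qnorm2 x = 0 \<longleftrightarrow> x = 0"
  unfolding qnorm2_def by (simp add: quat_eq_iff quat_ops sum_power2_eq_zero_iff add_nonneg_eq_0_iff)

instance
proof
  fix x :: quat
  assume "x \<noteq> 0"
  then have nz: "qnorm2 x \<noteq> 0" by (simp add: qnorm2_eq_0)
  have "qnorm2 x = qre x * qre x + qi x * qi x + qj x * qj x + qk x * qk x"
    by (simp add: qnorm2_def power2_eq_square)
  then have "(qre x * qre x + qi x * qi x + qj x * qj x + qk x * qk x) / qnorm2 x = 1"
    using nz by simp
  then have one: "qre x * qre x / qnorm2 x + qi x * qi x / qnorm2 x
      + qj x * qj x / qnorm2 x + qk x * qk x / qnorm2 x = 1"
    by (simp only: add_divide_distrib)
  show "inverse x * x = 1" "x * inverse x = 1"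
    using one by (simp_all add: quat_eq_iff quat_ops inverse_quat_def algebra_simps)
qed (simp_all add: quat_eq_iff quat_ops inverse_quat_def divide_quat_def algebra_simps)

end

definition unit_i :: quat where "unit_i = Quat 0 1 0 0"
definition unit_j :: quat where "unit_j = Quat 0 0 1 0"
definition unit_k :: quat where "unit_k = Quat 0 0 0 1"

lemma unit_relations:
  "unit_i * unit_i = -1" "unit_j * unit_j = -1" "unit_k * unit_k = -1"
  "unit_i * unit_j = unit_k" "unit_j * unit_k = unit_i" "unit_k * unit_i = unit_j"
  "unit_j * unit_i = - unit_k" "unit_k * unit_j = - unit_i" "unit_i * unit_k = - unit_j"
  by (simp_all add: unit_i_def unit_j_def unit_k_def quat_ops)

lemma quat_expansion:
  "x = of_real (qre x) + of_real (qi x) * unit_i + of_real (qj x) * unit_j + of_real (qk x) * unit_k"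
  by (simp add: of_real_def unit_i_def unit_j_def unit_k_def quat_ops)

definition quat_of_complex :: "complex \<Rightarrow> quat" where
  "quat_of_complex z = of_real (Re z) + of_real (Im z) * unit_i"

definition uni_poly :: "nat \<Rightarrow> (nat \<Rightarrow> quat) \<Rightarrow> quat \<Rightarrow> quat" where
  "uni_poly n a q = q ^ n - (\<Sum>s<n. a s * q ^ s)"

(* Rows and columns are indexed from 0. *)
definition quat_companion :: "nat \<Rightarrow> (nat \<Rightarrow> quat) \<Rightarrow> quat mat" where
  "quat_companion n a =
     mat n n (\<lambda>(r, c). if r = 0 then a (n - 1 - c) else if r = c + 1 then 1 else 0)"

(* The library's eigenvector predicate multiplies by the eigenvalue on the left,
   so it does not describe the right eigenvalue problem over a skew field. *)
definition right_eigenvector :: "quat mat \<Rightarrow> quat vec \<Rightarrow> quat \<Rightarrow> bool" where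
  "right_eigenvector A v l \<longleftrightarrow>
     v \<in> carrier_vec (dim_row A) \<and> v \<noteq> 0\<^sub>v (dim_row A) \<and> A *\<^sub>v v = map_vec (\<lambda>x. x * l) v"

end

theory Submission
  imports Defs
begin

text \<open>
  The rows of the companion matrix below the first one force a right eigenvector to be geometric:
  read from the bottom up, its entries are \<open>\<phi>, \<phi> \<lambda>, \<phi> \<lambda>\<^sup>2, \<dots>\<close>, where \<open>\<phi>\<close> is the last entry
  (\<open>companion_eigenvector_entry\<close>). If \<open>\<phi>\<close> were zero, so would be the whole vector.
  The first row then says \<open>\<Sum>\<^sub>s a\<^sub>s \<phi> \<lambda>\<^sup>s = \<phi> \<lambda>\<^sup>n\<close>. Since the quotient \<open>q\<close> of the last two
  entries is the conjugate \<open>\<phi> \<lambda> \<phi>\<inverse>\<close>, the powers satisfy \<open>q\<^sup>s \<phi> = \<phi> \<lambda>\<^sup>s\<close>, which turns this equation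
  into \<open>A\<^sub>n(q) \<phi> = 0\<close>. It remains to cancel \<open>\<phi>\<close>. Noncommutativity is harmless because the coefficients
  stand on the left of \<open>\<phi>\<close> throughout and the eigenvalue on its right.
\<close>

lemma power_conjugate_mult:
  fixes x y :: "'a::division_ring"
  assumes "x \<noteq> 0"
  shows "(x * y * inverse x) ^ s * x = x * y ^ s"
proof (induction s)
  case (Suc s)
  have "(x * y * inverse x) ^ Suc s * x = x * y * inverse x * ((x * y * inverse x) ^ s * x)"
    by (simp add: mult.assoc)
  also have "\<dots> = x * y * (inverse x * x) * y ^ s"
    unfolding Suc.IH by (simp only: mult.assoc)
  also have "\<dots> = x * y ^ Suc s"
    using assms by (simp add: mult.assoc)
  finally show ?case .
qed simp

lemma companion_eigenvector_carrier:
  assumes "right_eigenvector (quat_companion n a) \<Phi> l"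
  shows "\<Phi> \<in> carrier_vec n"
  using assms by (simp add: right_eigenvector_def quat_companion_def)

lemma companion_eigenvector_row:
  assumes "right_eigenvector (quat_companion n a) \<Phi> l" and "r < n"
  shows "(\<Sum>c<n. quat_companion n a $$ (r, c) * \<Phi> $ c) = \<Phi> $ r * l"
proof -
  have dim: "dim_vec \<Phi> = n"
    using companion_eigenvector_carrier[OF assms(1)] by simp
  have "\<Phi> $ r * l = (quat_companion n a *\<^sub>v \<Phi>) $ r"
    using assms dim by (simp add: right_eigenvector_def)
  also have "\<dots> = (\<Sum>c<n. quat_companion n a $$ (r, c) * \<Phi> $ c)"
    using assms(2) dim
    by (auto simp: scalar_prod_def quat_companion_def lessThan_atLeast0 intro!: sum.cong)
  finally show ?thesis by simp
qed

lemma companion_eigenvector_step: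
  assumes "right_eigenvector (quat_companion n a) \<Phi> l" and "Suc r < n"
  shows "\<Phi> $ r = \<Phi> $ Suc r * l"
proof -
  have "\<Phi> $ Suc r * l = (\<Sum>c<n. quat_companion n a $$ (Suc r, c) * \<Phi> $ c)"
    using companion_eigenvector_row[OF assms] by simp
  also have "\<dots> = (\<Sum>c<n. if r = c then \<Phi> $ c else 0)"
    using assms(2) by (intro sum.cong) (auto simp: quat_companion_def)
  also have "\<dots> = \<Phi> $ r"
    using assms(2) by simp
  finally show ?thesis by simp
qed

lemma companion_eigenvector_entry:
  assumes "right_eigenvector (quat_companion n a) \<Phi> l" and "k < n"
  shows "\<Phi> $ (n - 1 - k) = \<Phi> $ (n - 1) * l ^ k"
  using assms(2)
proof (induction k)
  case (Suc k)
  then have "Suc (n - 1 - Suc k) = n - 1 - k" by simp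
  moreover have "Suc (n - 1 - Suc k) < n" using Suc.prems by simp
  ultimately have "\<Phi> $ (n - 1 - Suc k) = \<Phi> $ (n - 1 - k) * l"
    using companion_eigenvector_step[OF assms(1)] by metis
  then show ?case
    using Suc by (simp add: mult.assoc power_commutes)
qed simp

lemma companion_eigenvector_last_nonzero:
  assumes "right_eigenvector (quat_companion n a) \<Phi> l"
  shows "\<Phi> $ (n - 1) \<noteq> 0"
proof
  assume zero: "\<Phi> $ (n - 1) = 0"
  have "\<Phi> $ r = 0" if "r < n" for r
    using companion_eigenvector_entry[OF assms, of "n - 1 - r"] that zero by simp
  then have "\<Phi> = 0\<^sub>v n"
    using companion_eigenvector_carrier[OF assms] by (intro eq_vecI) auto
  then show False
    using assms by (simp add: right_eigenvector_def quat_companion_def)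
qed

text \<open>
  The lower rows determine the vector up to its last entry, so the first row is the only real
  constraint on \<open>\<lambda>\<close>; for commuting entries it would be the characteristic equation.
\<close>
lemma companion_eigenvector_first_row:
  assumes "right_eigenvector (quat_companion n a) \<Phi> l" and "n > 0"
  shows "(\<Sum>s<n. a s * (\<Phi> $ (n - 1) * l ^ s)) = \<Phi> $ (n - 1) * l ^ n"
proof -
  have "(\<Sum>s<n. a s * (\<Phi> $ (n - 1) * l ^ s)) = (\<Sum>s<n. a s * \<Phi> $ (n - 1 - s))"
    by (intro sum.cong refl) (simp only: companion_eigenvector_entry[OF assms(1)] lessThan_iff)
  also have "\<dots> = (\<Sum>c<n. a (n - 1 - c) * \<Phi> $ c)"
    by (rule sum.reindex_bij_witness[of _ "\<lambda>c. n - 1 - c" "\<lambda>s. n - 1 - s"]) auto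
  also have "\<dots> = (\<Sum>c<n. quat_companion n a $$ (0, c) * \<Phi> $ c)"
    by (intro sum.cong) (auto simp: quat_companion_def)
  also have "\<dots> = \<Phi> $ 0 * l"
    using companion_eigenvector_row[OF assms] .
  also have "\<dots> = \<Phi> $ (n - 1) * l ^ (n - 1) * l"
    using companion_eigenvector_entry[OF assms(1), of "n - 1"] assms(2) by simp
  also have "\<dots> = \<Phi> $ (n - 1) * l ^ n"
    using assms(2) by (cases n) (simp_all add: mult.assoc power_commutes)
  finally show ?thesis .
qed

lemma uni_poly_companion_eigenvector:
  assumes ev: "right_eigenvector (quat_companion n a) \<Phi> l" and "n \<ge> 2"
  shows "uni_poly n a (\<Phi> $ (n - 2) * inverse (\<Phi> $ (n - 1))) = 0"
proof -
  define \<phi> where "\<phi> = \<Phi> $ (n - 1)"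
  define q where "q = \<Phi> $ (n - 2) * inverse \<phi>"
  have nz: "\<phi> \<noteq> 0"
    unfolding \<phi>_def by (rule companion_eigenvector_last_nonzero[OF ev])
  have "\<Phi> $ (n - 1 - 1) = \<phi> * l"
    using companion_eigenvector_entry[OF ev, of 1] \<open>n \<ge> 2\<close> by (simp add: \<phi>_def)
  then have "q = \<phi> * l * inverse \<phi>"
    by (simp add: q_def numeral_2_eq_2)
  then have pow: "q ^ s * \<phi> = \<phi> * l ^ s" for s
    using power_conjugate_mult[OF nz] by simp
  have "uni_poly n a q * \<phi> = \<phi> * l ^ n - (\<Sum>s<n. a s * (\<phi> * l ^ s))"
    by (simp add: uni_poly_def left_diff_distrib sum_distrib_right mult.assoc pow)
  also have "\<dots> = 0"
    using companion_eigenvector_first_row[OF ev] \<open>n \<ge> 2\<close> by (simp add: \<phi>_def)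
  finally show ?thesis
    using nz by (simp add: q_def \<phi>_def)
qed

theorem theoremB:
  fixes n :: nat and a :: "nat \<Rightarrow> quat" and \<Phi> :: "quat vec" and l :: complex
  assumes "n \<ge> 2"
    and "right_eigenvector (quat_companion n a) \<Phi> (quat_of_complex l)"
    and "Im l \<ge> 0"
  shows "\<Phi> $ (n - 1) \<noteq> 0 \<and> uni_poly n a (\<Phi> $ (n - 2) * inverse (\<Phi> $ (n - 1))) = 0"
  using companion_eigenvector_last_nonzero[OF assms(2)]
    uni_poly_companion_eigenvector[OF assms(2,1)]
  by blast

end
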